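(* Let $p>3$ be a prime, $\zeta_p$ a primitive $p$-th root of unity, and $K=\mathbb{Q}(\zeta_p)$ with ring of integers $\mathbb{Z}[\zeta_p]$. Let $u\in\mathbb{Z}[\zeta_p]$ be a unit which is not real, and let $A(u)\in SL_{p-1}(\mathbb{Z})$ be the matrix of the $\mathbb{Z}$-linear map $x\mapsto ux$ on $\mathbb{Z}[\zeta_p]$ with respect to an integral basis. Then $A(u)^k$ is primitive for every integer $k\not\equiv 0 \pmod p$.
   Context: For an integer matrix $A\in\operatorname{Mat}_r(\mathbb{Z})$, $A\neq I$, $\gcd(A-I)$ denotes the greatest common divisor of the entries of $A-I$ (equivalently, the largest $N\geq1$ with $A\equiv I \bmod N$). $A$ is called primitive if $\gcd(A-I)=1$. *)

theory Defs
  imports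
    Complex_Main
    "HOL-Number_Theory.Cong"
    "HOL-Computational_Algebra.Primes"
    "HOL-Computational_Algebra.Polynomial"
    "Jordan_Normal_Form.Determinant"
begin

definition primitive_root_of_unity :: "nat \<Rightarrow> complex \<Rightarrow> bool" where
  "primitive_root_of_unity n z \<longleftrightarrow> 0 < n \<and> z ^ n = 1 \<and> (\<forall>m. 0 < m \<and> m < n \<longrightarrow> z ^ m \<noteq> 1)"

definition int_adjoin :: "complex \<Rightarrow> complex set" where
  "int_adjoin z = range (\<lambda>f :: int poly. poly (map_poly of_int f) z)"

definition unit_in :: "complex set \<Rightarrow> complex \<Rightarrow> bool" where
  "unit_in R u \<longleftrightarrow> u \<in> R \<and> (\<exists>v\<in>R. u * v = 1)"

text \<open>The family \<open>b 0, \<dots>, b (n - 1)\<close> is a \<open>\<int>\<close>-basis of \<open>R\<close>; values \<open>b i\<close> with \<open>i \<ge> n\<close>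
  are irrelevant.\<close>
definition integral_basis :: "complex set \<Rightarrow> nat \<Rightarrow> (nat \<Rightarrow> complex) \<Rightarrow> bool" where
  "integral_basis R n b \<longleftrightarrow>
     (\<forall>i<n. b i \<in> R) \<and>
     (\<forall>x\<in>R. \<exists>c :: nat \<Rightarrow> int. x = (\<Sum>i<n. of_int (c i) * b i)) \<and>
     (\<forall>c :: nat \<Rightarrow> int. (\<Sum>i<n. of_int (c i) * b i) = 0 \<longrightarrow> (\<forall>i<n. c i = 0))"

text \<open>Column convention: column \<open>j\<close> of the matrix holds the coordinates of \<open>T (b j)\<close>.\<close>
definition is_matrix_of :: "nat \<Rightarrow> (nat \<Rightarrow> complex) \<Rightarrow> (complex \<Rightarrow> complex) \<Rightarrow> int mat \<Rightarrow> bool" where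
  "is_matrix_of n b T A \<longleftrightarrow>
     A \<in> carrier_mat n n \<and> (\<forall>j<n. T (b j) = (\<Sum>i<n. of_int (A $$ (i, j)) * b i))"

lemma ex1_is_matrix_of:
  assumes b: "integral_basis R n b" and T: "\<And>x. x \<in> R \<Longrightarrow> T x \<in> R"
  shows "\<exists>!A. is_matrix_of n b T A"
proof (rule ex_ex1I)
  have "\<forall>j. \<exists>c :: nat \<Rightarrow> int. j < n \<longrightarrow> T (b j) = (\<Sum>i<n. of_int (c i) * b i)"
    using b T unfolding integral_basis_def by blast
  then obtain c :: "nat \<Rightarrow> nat \<Rightarrow> int"
    where c: "\<And>j. j < n \<Longrightarrow> T (b j) = (\<Sum>i<n. of_int (c j i) * b i)" by metis
  have "is_matrix_of n b T (mat n n (\<lambda>(i, j). c j i))"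
    unfolding is_matrix_of_def by (auto simp: c)
  then show "\<exists>A. is_matrix_of n b T A" ..
next
  fix A B assume A: "is_matrix_of n b T A" and B: "is_matrix_of n b T B"
  have "A $$ (i, j) = B $$ (i, j)" if "i < n" "j < n" for i j
  proof -
    have "(\<Sum>i<n. of_int (A $$ (i, j) - B $$ (i, j)) * b i) = T (b j) - T (b j)"
      using A B that(2) unfolding is_matrix_of_def
      by (simp add: left_diff_distrib sum_subtractf)
    then have "(\<Sum>i<n. of_int (A $$ (i, j) - B $$ (i, j)) * b i) = 0" by simp
    then have "\<forall>i<n. A $$ (i, j) - B $$ (i, j) = 0"
      using b[unfolded integral_basis_def, THEN conjunct2, THEN conjunct2,
          THEN spec[where x = "\<lambda>i. A $$ (i, j) - B $$ (i, j)"]] by blast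
    then show ?thesis using that(1) by simp
  qed
  with A B show "A = B" unfolding is_matrix_of_def by (intro eq_matI) auto
qed

text \<open>The identity matrix is not primitive, since the greatest common divisor is then \<open>0\<close>.\<close>
definition primitive_mat :: "int mat \<Rightarrow> bool" where
  "primitive_mat A \<longleftrightarrow> Gcd (elements_mat (A - 1\<^sub>m (dim_row A))) = 1"

definition special_linear_int :: "nat \<Rightarrow> int mat set" where
  "special_linear_int n = {A \<in> carrier_mat n n. det A = 1}"

text \<open>Integer powers are taken in the multiplicative monoid of the matrix ring over \<open>\<int>\<close>, so that
  for \<open>k < 0\<close> the power is the inverse, over \<open>\<int>\<close>, of the \<open>- k\<close>-th power.\<close>
abbreviation int_mat_power :: "nat \<Rightarrow> int mat \<Rightarrow> int \<Rightarrow> int mat" where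
  "int_mat_power n A k \<equiv> A [^]\<^bsub>ring_mat TYPE(int) n ()\<^esub> k"

end

theory Submission
  imports
    Defs
    "HOL-Number_Theory.Residues"
begin

text \<open>
  Let \<open>R = \<int>[\<zeta>]\<close>. By Kummer's lemma \<open>u = \<zeta>\<^sup>m \<cdot> cnj u\<close> for some \<open>m\<close>, and \<open>p\<close> does not divide \<open>m\<close> as \<open>u\<close> is
  not real. If \<open>A\<^sup>k \<equiv> I\<close> modulo \<open>N\<close>, then \<open>u\<^sup>k \<equiv> 1\<close> modulo \<open>N R\<close>, hence also \<open>cnj u\<^sup>k \<equiv> 1\<close>, and
  dividing gives \<open>\<zeta>\<^bsup>mk\<^esup> \<equiv> 1\<close> modulo \<open>N R\<close>. Comparing coefficients forces \<open>N = 1\<close>.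

  Kummer's lemma needs no theorem of Kronecker here. Write \<open>w = u / cnj u = \<Sum>\<^sub>i c\<^sub>i \<zeta>\<^sup>i\<close>, where the integers
  \<open>c\<^sub>i\<close> (\<open>i < p\<close>) are determined up to a common shift. The Frobenius congruence
  \<open>(\<Sum>\<^sub>i c\<^sub>i \<zeta>\<^sup>i)\<^sup>p \<equiv> \<Sum>\<^sub>i c\<^sub>i\<close> modulo \<open>p R\<close> shows \<open>\<Sum>\<^sub>i c\<^sub>i \<equiv> 1\<close> modulo \<open>p\<close>, so that one may shift to
  \<open>\<Sum>\<^sub>i c\<^sub>i = 1\<close>. Expanding \<open>w \<cdot> cnj w = 1\<close> then gives \<open>\<Sum>\<^sub>i c\<^sub>i\<^sup>2 = 1\<close>, so \<open>w\<close> is a power of \<open>\<zeta>\<close>.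

  The same congruence \<open>u\<^sup>p \<equiv> a\<close> modulo \<open>p R\<close> yields \<open>det A\<^sup>p \<equiv> a\<^bsup>p-1\<^esup> \<equiv> 1\<close> modulo \<open>p\<close>, which excludes
  \<open>det A = -1\<close>. Linear independence of \<open>1, \<zeta>, \<dots>, \<zeta>\<^bsup>p-2\<^esup>\<close> is not derived from irreducibility of the
  cyclotomic polynomial: these elements generate \<open>R\<close>, which by assumption has a basis of the same size.
\<close>

section \<open>The ring generated by a complex number\<close>

lemma of_int_in_int_adjoin: "of_int k \<in> int_adjoin z"
  unfolding int_adjoin_def by (rule range_eqI[of _ _ "[:k:]"]) (simp add: map_poly_pCons)

lemma self_in_int_adjoin: "z \<in> int_adjoin z"
  unfolding int_adjoin_def by (rule range_eqI[of _ _ "[:0, 1:]"]) (simp add: map_poly_pCons)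

lemma add_in_int_adjoin:
  assumes "x \<in> int_adjoin z" "y \<in> int_adjoin z"
  shows "x + y \<in> int_adjoin z"
proof -
  obtain f g where "x = poly (map_poly of_int f) z" "y = poly (map_poly of_int g) z"
    using assms unfolding int_adjoin_def by blast
  moreover have "map_poly complex_of_int (f + g) = map_poly of_int f + map_poly of_int g"
    by (intro poly_eqI) (simp add: coeff_map_poly)
  ultimately have "x + y = poly (map_poly of_int (f + g)) z" by simp
  then show ?thesis unfolding int_adjoin_def by blast
qed

lemma mult_in_int_adjoin:
  assumes "x \<in> int_adjoin z" "y \<in> int_adjoin z"
  shows "x * y \<in> int_adjoin z"
proof -
  obtain f g where "x = poly (map_poly of_int f) z" "y = poly (map_poly of_int g) z"
    using assms unfolding int_adjoin_def by blast
  moreover have "map_poly complex_of_int (f * g) = map_poly of_int f * map_poly of_int g"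
    by (intro poly_eqI) (simp add: coeff_map_poly coeff_mult)
  ultimately have "x * y = poly (map_poly of_int (f * g)) z" by simp
  then show ?thesis unfolding int_adjoin_def by blast
qed

lemma power_in_int_adjoin: "x \<in> int_adjoin z \<Longrightarrow> x ^ n \<in> int_adjoin z"
  by (induction n) (use of_int_in_int_adjoin[of 1] in \<open>auto intro: mult_in_int_adjoin\<close>)

lemma sum_in_int_adjoin: "(\<And>i. i \<in> I \<Longrightarrow> f i \<in> int_adjoin z) \<Longrightarrow> sum f I \<in> int_adjoin z"
  by (induction I rule: infinite_finite_induct)
    (use of_int_in_int_adjoin[of 0] in \<open>auto intro: add_in_int_adjoin\<close>)

lemma of_nat_in_int_adjoin: "of_nat k \<in> int_adjoin z"
  using of_int_in_int_adjoin[of "int k"] by simp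

lemma diff_in_int_adjoin: "x \<in> int_adjoin z \<Longrightarrow> y \<in> int_adjoin z \<Longrightarrow> x - y \<in> int_adjoin z"
  using add_in_int_adjoin[OF _ mult_in_int_adjoin[OF of_int_in_int_adjoin], of x z y "- 1"] by simp

lemmas int_adjoin_closed =
  of_int_in_int_adjoin of_nat_in_int_adjoin self_in_int_adjoin add_in_int_adjoin
  diff_in_int_adjoin mult_in_int_adjoin power_in_int_adjoin sum_in_int_adjoin

lemma int_adjoin_subset:
  assumes "x \<in> int_adjoin y" "y \<in> int_adjoin z"
  shows "x \<in> int_adjoin z"
proof -
  obtain f where "x = poly (map_poly of_int f) y"
    using assms(1) unfolding int_adjoin_def by blast
  then show ?thesis
    by (auto simp: poly_altdef coeff_map_poly intro!: int_adjoin_closed assms(2))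
qed

lemma cnj_in_int_adjoin_cnj:
  assumes "x \<in> int_adjoin z"
  shows "cnj x \<in> int_adjoin (cnj z)"
proof -
  obtain f where "x = poly (map_poly of_int f) z"
    using assms unfolding int_adjoin_def by blast
  then have "cnj x = (\<Sum>i\<le>degree (map_poly complex_of_int f). of_int (poly.coeff f i) * cnj z ^ i)"
    by (simp add: poly_altdef coeff_map_poly)
  then show ?thesis by (auto intro!: int_adjoin_closed)
qed

text \<open>Exponents are reduced modulo \<open>n\<close>, and coefficients in the same residue
  class are added up. The resulting \<open>c\<close> need not be unique.\<close>

lemma int_adjoin_root_of_unity:
  assumes "z ^ n = 1" "0 < n" "x \<in> int_adjoin z"
  obtains c :: "nat \<Rightarrow> int" where "x = (\<Sum>i<n. of_int (c i) * z ^ i)"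
proof -
  obtain f where f: "x = poly (map_poly of_int f) z"
    using assms(3) unfolding int_adjoin_def by blast
  let ?d = "degree (map_poly complex_of_int f)"
  have pow: "z ^ i = z ^ (i mod n)" for i
  proof -
    have "z ^ i = z ^ (n * (i div n) + i mod n)" by simp
    also have "\<dots> = z ^ (i mod n)" by (simp only: power_add power_mult assms(1) power_one mult_1)
    finally show ?thesis .
  qed
  have "x = (\<Sum>i\<le>?d. of_int (poly.coeff f i) * z ^ (i mod n))"
    using pow by (simp add: f poly_altdef coeff_map_poly)
  also have "\<dots> = (\<Sum>k<n. \<Sum>i\<in>{i \<in> {..?d}. i mod n = k}. of_int (poly.coeff f i) * z ^ (i mod n))"
    by (rule sum.group[symmetric]) (use assms(2) in auto)
  also have "\<dots> = (\<Sum>k<n. of_int (\<Sum>i\<in>{i \<in> {..?d}. i mod n = k}. poly.coeff f i) * z ^ k)"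
    by (intro sum.cong refl) (auto simp: sum_distrib_right)
  finally show ?thesis by (rule that)
qed

section \<open>Integral bases and matrices of multiplication maps\<close>

text \<open>A surjective endomorphism of a free module of finite rank is injective: the change of
  coordinates \<open>MQ\<close> from \<open>e\<close> to \<open>b\<close> has a right inverse, so
  its determinant is nonzero and a relation among the \<open>e i\<close> cannot be a nonzero kernel
  vector.\<close>

lemma generators_integral_basis:
  assumes b: "integral_basis R n b"
    and e: "\<And>i. i < n \<Longrightarrow> e i \<in> R"
    and gen: "\<And>x. x \<in> R \<Longrightarrow> \<exists>c :: nat \<Rightarrow> int. x = (\<Sum>i<n. of_int (c i) * e i)"
  shows "integral_basis R n e"
proof -
  have b_in: "\<And>i. i < n \<Longrightarrow> b i \<in> R"
    and b_gen: "\<And>x. x \<in> R \<Longrightarrow> \<exists>c :: nat \<Rightarrow> int. x = (\<Sum>i<n. of_int (c i) * b i)"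
    and indep: "\<And>(c :: nat \<Rightarrow> int) i. (\<Sum>i<n. of_int (c i) * b i) = 0 \<Longrightarrow> i < n \<Longrightarrow> c i = 0"
    using b unfolding integral_basis_def by simp_all
  have "\<forall>j. \<exists>c :: nat \<Rightarrow> int. j < n \<longrightarrow> b j = (\<Sum>i<n. of_int (c i) * e i)"
    using gen[OF b_in] by blast
  then obtain P :: "nat \<Rightarrow> nat \<Rightarrow> int"
    where P: "\<And>j. j < n \<Longrightarrow> b j = (\<Sum>i<n. of_int (P j i) * e i)" by metis
  have "\<forall>j. \<exists>c :: nat \<Rightarrow> int. j < n \<longrightarrow> e j = (\<Sum>i<n. of_int (c i) * b i)"
    using b_gen[OF e] by blast
  then obtain Q :: "nat \<Rightarrow> nat \<Rightarrow> int"
    where Q: "\<And>j. j < n \<Longrightarrow> e j = (\<Sum>i<n. of_int (Q j i) * b i)" by metis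
  have comb: "(\<Sum>i<n. of_int (c i) * e i) = (\<Sum>k<n. of_int (\<Sum>i<n. Q i k * c i) * b k)"
    for c :: "nat \<Rightarrow> int"
  proof -
    have "(\<Sum>i<n. of_int (c i) * e i) = (\<Sum>i<n. \<Sum>k<n. of_int (Q i k * c i) * b k)"
      by (intro sum.cong refl) (simp add: Q sum_distrib_left mult_ac)
    also have "\<dots> = (\<Sum>k<n. \<Sum>i<n. of_int (Q i k * c i) * b k)" by (rule sum.swap)
    finally show ?thesis by (simp add: sum_distrib_right)
  qed
  define MP where "MP = mat n n (\<lambda>(i, j). P j i)"
  define MQ where "MQ = mat n n (\<lambda>(i, j). Q j i)"
  have MQ: "MQ \<in> carrier_mat n n" and MP: "MP \<in> carrier_mat n n" by (auto simp: MP_def MQ_def)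
  \<comment> \<open>Rewriting \<open>b j\<close> through \<open>e\<close> and back must return the
    \<open>j\<close>-th unit vector, by independence of \<open>b\<close>.\<close>
  have "(\<Sum>i<n. Q i k * P j i) = (if k = j then 1 else 0)" if "k < n" "j < n" for k j
  proof -
    have "(\<Sum>k<n. of_int ((\<Sum>i<n. Q i k * P j i) - (if k = j then 1 else 0)) * b k)
        = b j - (\<Sum>k<n. of_int (if k = j then 1 else 0) * b k)"
      using P[OF that(2)] by (simp only: comb of_int_diff left_diff_distrib sum_subtractf)
    also have "(\<Sum>k<n. of_int (if k = j then 1 else 0) * b k) = (\<Sum>k<n. if k = j then b k else 0)"
      by (intro sum.cong) auto
    also have "\<dots> = b j" using that(2) by simp
    finally show ?thesis
      using indep[of "\<lambda>k. (\<Sum>i<n. Q i k * P j i) - (if k = j then 1 else 0)" k] that(1) by simp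
  qed
  then have "MQ * MP = 1\<^sub>m n"
    by (intro eq_matI) (auto simp: MP_def MQ_def scalar_prod_def lessThan_atLeast0)
  then have "det MQ \<noteq> 0" using det_mult[OF MQ MP] by auto
  have "c i = 0" if c: "(\<Sum>i<n. of_int (c i) * e i) = 0" and "i < n" for c :: "nat \<Rightarrow> int" and i
  proof -
    have "(\<Sum>i<n. Q i k * c i) = 0" if "k < n" for k
      using indep[of "\<lambda>k. \<Sum>i<n. Q i k * c i" k] that c by (simp only: comb)
    then have "MQ *\<^sub>v vec n c = 0\<^sub>v n"
      by (intro eq_vecI) (auto simp: MQ_def scalar_prod_def lessThan_atLeast0)
    then have "vec n c = 0\<^sub>v n"
      using \<open>det MQ \<noteq> 0\<close> det_0_iff_vec_prod_zero[OF MQ] vec_carrier by blast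
    then show ?thesis using \<open>i < n\<close> by (metis index_vec index_zero_vec(1))
  qed
  then show ?thesis unfolding integral_basis_def using e gen by simp
qed

section \<open>Products, powers and inverses of multiplication matrices\<close>

lemma is_matrix_of_mult:
  assumes A: "is_matrix_of n b (\<lambda>x. s * x) A" and B: "is_matrix_of n b (\<lambda>x. t * x) B"
  shows "is_matrix_of n b (\<lambda>x. s * t * x) (A * B)"
proof -
  have carr: "A \<in> carrier_mat n n" "B \<in> carrier_mat n n"
    using A B unfolding is_matrix_of_def by auto
  have "s * t * b j = (\<Sum>k<n. of_int ((A * B) $$ (k, j)) * b k)" if "j < n" for j
  proof -
    have "s * t * b j = s * (\<Sum>i<n. of_int (B $$ (i, j)) * b i)"
      using B that unfolding is_matrix_of_def by (simp add: mult.assoc)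
    also have "\<dots> = (\<Sum>i<n. of_int (B $$ (i, j)) * (s * b i))"
      by (simp add: sum_distrib_left mult_ac)
    also have "\<dots> = (\<Sum>i<n. \<Sum>k<n. of_int (A $$ (k, i) * B $$ (i, j)) * b k)"
      using A unfolding is_matrix_of_def
      by (intro sum.cong refl) (simp add: sum_distrib_left mult_ac)
    also have "\<dots> = (\<Sum>k<n. \<Sum>i<n. of_int (A $$ (k, i) * B $$ (i, j)) * b k)" by (rule sum.swap)
    also have "\<dots> = (\<Sum>k<n. of_int ((A * B) $$ (k, j)) * b k)"
      using carr that
      by (intro sum.cong refl) (simp add: scalar_prod_def lessThan_atLeast0 sum_distrib_right)
    finally show ?thesis .
  qed
  then show ?thesis using carr unfolding is_matrix_of_def by simp
qed

lemma is_matrix_of_one: "is_matrix_of n b (\<lambda>x. 1 * x) (1\<^sub>m n)"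
proof -
  have "(\<Sum>i<n. of_int ((1\<^sub>m n :: int mat) $$ (i, j)) * b i) = b j" if "j < n" for j
  proof -
    have "(\<Sum>i<n. of_int ((1\<^sub>m n :: int mat) $$ (i, j)) * b i) = (\<Sum>i<n. if i = j then b i else 0)"
      using that by (intro sum.cong) auto
    then show ?thesis using that by simp
  qed
  then show ?thesis unfolding is_matrix_of_def by simp
qed

lemma is_matrix_of_power:
  assumes "is_matrix_of n b (\<lambda>x. s * x) A"
  shows "is_matrix_of n b (\<lambda>x. s ^ k * x) (A [^]\<^bsub>ring_mat TYPE(int) n ()\<^esub> k)"
proof (induction k)
  case 0
  show ?case using is_matrix_of_one by (simp add: nat_pow_def ring_mat_simps)
next
  case (Suc k)
  show ?case using is_matrix_of_mult[OF Suc.IH assms]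
    by (simp add: nat_pow_def ring_mat_simps power_Suc2 del: power_Suc)
qed

text \<open>The inverse is the matrix of multiplication by \<open>v\<close>, the inverse of
  \<open>u\<close> in \<open>R\<close>; uniqueness of matrices identifies both products with the
  identity.\<close>

lemma is_matrix_of_inverse:
  assumes b: "integral_basis R n b"
    and closed: "\<And>x y. x \<in> R \<Longrightarrow> y \<in> R \<Longrightarrow> x * y \<in> R"
    and u: "unit_in R u" and A: "is_matrix_of n b (\<lambda>x. u * x) A"
  obtains B where "B \<in> carrier_mat n n" "A * B = 1\<^sub>m n" "B * A = 1\<^sub>m n"
proof -
  obtain v where v: "v \<in> R" "u * v = 1" "v * u = 1"
    using u unfolding unit_in_def by (auto simp: mult.commute)
  obtain B where B: "is_matrix_of n b (\<lambda>x. v * x) B"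
    using ex1_is_matrix_of[OF b, of "\<lambda>x. v * x"] closed v(1) by blast
  have uniq: "C = 1\<^sub>m n" if "is_matrix_of n b (\<lambda>x. 1 * x) C" for C
    using ex1_is_matrix_of[OF b, of "\<lambda>x. 1 * x"] is_matrix_of_one[of n b] that by auto
  show ?thesis
  proof (rule that)
    show "B \<in> carrier_mat n n" using B unfolding is_matrix_of_def by simp
    show "A * B = 1\<^sub>m n" "B * A = 1\<^sub>m n"
      using is_matrix_of_mult[OF A B] is_matrix_of_mult[OF B A] v(2,3)
      by (auto intro!: uniq)
  qed
qed

section \<open>Congruences between integer matrices\<close>

lemma det_cong:
  fixes A B :: "int mat"
  assumes "A \<in> carrier_mat n n" "B \<in> carrier_mat n n"
    and "\<And>i j. i < n \<Longrightarrow> j < n \<Longrightarrow> [A $$ (i, j) = B $$ (i, j)] (mod m)"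
  shows "[det A = det B] (mod m)"
  \<comment> \<open>By the Leibniz formula the determinant is an integer polynomial in the
    entries.\<close>
  unfolding det_def'[OF assms(1)] det_def'[OF assms(2)]
proof (intro cong_sum cong_mult cong_prod cong_refl)
  fix \<pi> i assume "\<pi> \<in> {\<pi>. \<pi> permutes {0..<n}}" "i \<in> {0..<n}"
  then show "[A $$ (i, \<pi> i) = B $$ (i, \<pi> i)] (mod m)"
    using assms(3) by (metis mem_Collect_eq permutes_in_image atLeastLessThan_iff)
qed

text \<open>Applied to \<open>u ^ p = a + p * r\<close>, this makes the matrix of
  \<open>u ^ p\<close> scalar modulo \<open>p\<close>.\<close>

lemma is_matrix_of_affine:
  assumes "is_matrix_of n b (\<lambda>x. t * x) M"
  shows "is_matrix_of n b (\<lambda>x. (of_int a + of_int N * t) * x) (a \<cdot>\<^sub>m 1\<^sub>m n + N \<cdot>\<^sub>m M)"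
proof -
  have M: "M \<in> carrier_mat n n" using assms unfolding is_matrix_of_def by blast
  have "(of_int a + of_int N * t) * b j
      = (\<Sum>i<n. of_int ((a \<cdot>\<^sub>m 1\<^sub>m n + N \<cdot>\<^sub>m M) $$ (i, j)) * b i)" if j: "j < n" for j
  proof -
    have one: "b j = (\<Sum>i<n. of_int (1\<^sub>m n $$ (i, j)) * b i)"
      using is_matrix_of_one[of n b] j unfolding is_matrix_of_def by simp
    have t: "t * b j = (\<Sum>i<n. of_int (M $$ (i, j)) * b i)"
      using assms j unfolding is_matrix_of_def by simp
    have "(of_int a + of_int N * t) * b j = of_int a * b j + of_int N * (t * b j)"
      by (simp add: algebra_simps)
    also have "\<dots> = (\<Sum>i<n. of_int (a * 1\<^sub>m n $$ (i, j) + N * M $$ (i, j)) * b i)"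
      unfolding t by (subst one) (simp add: sum_distrib_left sum.distrib distrib_right mult.assoc)
    also have "\<dots> = (\<Sum>i<n. of_int ((a \<cdot>\<^sub>m 1\<^sub>m n + N \<cdot>\<^sub>m M) $$ (i, j)) * b i)"
      using M j by (intro sum.cong refl) simp
    finally show ?thesis .
  qed
  then show ?thesis using M unfolding is_matrix_of_def by simp
qed

text \<open>The hypothesis puts every \<open>(s - 1) * b j\<close> into \<open>N R\<close>. Since
  \<open>1\<close> is an integer combination of the \<open>b j\<close>, the element
  \<open>s - 1\<close> lies there too.\<close>

lemma cong_1_of_matrix_cong_1:
  assumes b: "integral_basis (int_adjoin z) n b" and B: "is_matrix_of n b (\<lambda>x. s * x) B"
    and dvd: "\<And>i j. i < n \<Longrightarrow> j < n \<Longrightarrow> N dvd B $$ (i, j) - 1\<^sub>m n $$ (i, j)"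
  obtains y where "y \<in> int_adjoin z" "s - 1 = of_int N * y"
proof -
  have b_in: "\<And>i. i < n \<Longrightarrow> b i \<in> int_adjoin z" using b unfolding integral_basis_def by blast
  have "1 \<in> int_adjoin z" using of_int_in_int_adjoin[of 1] by simp
  then obtain c :: "nat \<Rightarrow> int" where c: "1 = (\<Sum>j<n. of_int (c j) * b j)"
    using b unfolding integral_basis_def by blast
  define D where "D i j = (B $$ (i, j) - 1\<^sub>m n $$ (i, j)) div N" for i j
  define y where "y = (\<Sum>j<n. of_int (c j) * (\<Sum>i<n. of_int (D i j) * b i))"
  have bj: "s * b j - b j = of_int N * (\<Sum>i<n. of_int (D i j) * b i)" if j: "j < n" for j
  proof -
    have "b j = (\<Sum>i<n. of_int (1\<^sub>m n $$ (i, j)) * b i)"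
      using is_matrix_of_one[of n b] j unfolding is_matrix_of_def by simp
    moreover have "s * b j = (\<Sum>i<n. of_int (B $$ (i, j)) * b i)"
      using B j unfolding is_matrix_of_def by simp
    ultimately have "s * b j - b j = (\<Sum>i<n. of_int (B $$ (i, j) - 1\<^sub>m n $$ (i, j)) * b i)"
      by (simp only: of_int_diff left_diff_distrib sum_subtractf)
    also have "\<dots> = (\<Sum>i<n. of_int (N * D i j) * b i)"
      using dvd j by (intro sum.cong refl) (simp add: D_def)
    finally show ?thesis by (simp add: sum_distrib_left mult.assoc)
  qed
  have "s - 1 = s * (\<Sum>j<n. of_int (c j) * b j) - (\<Sum>j<n. of_int (c j) * b j)"
    by (simp flip: c)
  also have "\<dots> = (\<Sum>j<n. of_int (c j) * (s * b j - b j))"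
    by (simp add: sum_distrib_left sum_subtractf right_diff_distrib mult_ac)
  also have "\<dots> = of_int N * y"
    unfolding y_def sum_distrib_left by (intro sum.cong refl) (simp add: bj sum_distrib_left mult_ac)
  finally have "s - 1 = of_int N * y" .
  moreover have "y \<in> int_adjoin z"
    unfolding y_def using b_in by (auto intro!: int_adjoin_closed)
  ultimately show ?thesis using that by blast
qed

text \<open>The \<open>Gcd\<close> is itself a common divisor of the entries, and being nonnegative
  it is \<open>1\<close> once it divides \<open>1\<close>.\<close>

lemma primitive_matI:
  assumes A: "A \<in> carrier_mat n n"
    and "\<And>N. (\<And>i j. i < n \<Longrightarrow> j < n \<Longrightarrow> N dvd A $$ (i, j) - 1\<^sub>m n $$ (i, j)) \<Longrightarrow> N dvd 1"
  shows "primitive_mat A"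
proof -
  let ?g = "Gcd (elements_mat (A - 1\<^sub>m n))"
  have "?g dvd 1"
  proof (rule assms(2))
    fix i j assume "i < n" "j < n"
    then have "A $$ (i, j) - 1\<^sub>m n $$ (i, j) \<in> elements_mat (A - 1\<^sub>m n)"
      using A by (intro elements_matI[of _ n n i j]) auto
    then show "?g dvd A $$ (i, j) - 1\<^sub>m n $$ (i, j)" by (rule Gcd_dvd)
  qed
  then show ?thesis using A unfolding primitive_mat_def by simp
qed

text \<open>From \<open>(C - I) * B = I - B\<close>. This reduces negative exponents to positive
  ones.\<close>

lemma dvd_minus_one_of_inverse:
  fixes B C :: "int mat"
  assumes B: "B \<in> carrier_mat n n" and C: "C \<in> carrier_mat n n" and CB: "C * B = 1\<^sub>m n"
    and dvd: "\<And>i j. i < n \<Longrightarrow> j < n \<Longrightarrow> N dvd C $$ (i, j) - 1\<^sub>m n $$ (i, j)"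
    and ij: "i < n" "j < n"
  shows "N dvd B $$ (i, j) - 1\<^sub>m n $$ (i, j)"
proof -
  have "(C - 1\<^sub>m n) * B = 1\<^sub>m n - B"
    using B C CB by (simp add: minus_mult_distrib_mat[of _ n n])
  then have "1\<^sub>m n $$ (i, j) - B $$ (i, j) = ((C - 1\<^sub>m n) * B) $$ (i, j)"
    using B ij by simp
  also have "\<dots> = (\<Sum>k = 0..<n. (C $$ (i, k) - 1\<^sub>m n $$ (i, k)) * B $$ (k, j))"
    using B C ij by (simp add: scalar_prod_def)
  finally have "N dvd 1\<^sub>m n $$ (i, j) - B $$ (i, j)"
    using dvd ij(1) by (auto intro!: dvd_sum dvd_mult2)
  then show ?thesis by (simp add: dvd_diff_commute)
qed

lemma det_nat_pow:
  assumes "A \<in> carrier_mat n n"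
  shows "det (A [^]\<^bsub>ring_mat TYPE(int) n ()\<^esub> (k :: nat)) = det A ^ k"
proof -
  interpret ring "ring_mat TYPE(int) n ()" by (rule ring_mat)
  show ?thesis
  proof (induction k)
    case (Suc k)
    have "A [^]\<^bsub>ring_mat TYPE(int) n ()\<^esub> k \<in> carrier_mat n n"
      using nat_pow_closed[of A k] assms by (simp add: ring_mat_simps)
    then show ?case using Suc.IH assms by (simp add: ring_mat_simps det_mult)
  qed (simp add: ring_mat_simps)
qed

section \<open>The Frobenius congruence\<close>

lemma fermat_int:
  assumes "prime p"
  shows "[(a :: int) ^ p = a] (mod int p)"
proof (cases "int p dvd a")
  case True
  then have "int p dvd a ^ p" using prime_gt_0_nat[OF assms] by (metis dvd_power dvd_trans)
  then show ?thesis using True by (simp add: cong_iff_dvd_diff)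
next
  case False
  \<comment> \<open>The natural representative \<open>r\<close> gives access to
    \<open>fermat_theorem\<close>, which is about naturals.\<close>
  define r where "r = nat (a mod int p)"
  have p: "p > 0" using assms by (rule prime_gt_0_nat)
  have ar: "[a = int r] (mod int p)" unfolding r_def using p by (simp add: cong_def)
  then have "\<not> p dvd r" using False by (meson cong_dvd_iff int_dvd_int_iff)
  then have "[int r ^ (p - 1) = 1] (mod int p)"
    using fermat_theorem[OF assms] by (metis cong_int_iff of_nat_1 of_nat_power)
  then have "[int r ^ (p - 1) * int r = 1 * int r] (mod int p)" by (rule cong_mult) simp
  then have "[int r ^ p = int r] (mod int p)"
    using p by (simp only: power_minus_mult mult_1)
  then show ?thesis using ar by (metis cong_pow cong_trans cong_sym)
qed

text \<open>The inner binomial coefficients are divisible by \<open>p\<close>, and dividing them by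
  \<open>p\<close> leaves integer coefficients in \<open>r\<close>.\<close>

lemma freshmans_dream_int_adjoin:
  assumes p: "prime p" and x: "x \<in> int_adjoin z" and y: "y \<in> int_adjoin z"
  obtains r where "r \<in> int_adjoin z" "(x + y) ^ p = x ^ p + y ^ p + of_nat p * r"
proof -
  define r where "r = (\<Sum>k\<in>{0<..<p}. of_nat ((p choose k) div p) * x ^ k * y ^ (p - k))"
  have p0: "p > 0" using p by (rule prime_gt_0_nat)
  have "of_nat (p choose k) = (of_nat p * of_nat ((p choose k) div p) :: complex)"
    if "k \<in> {0<..<p}" for k
    using dvd_choose_prime[of k p] that p by (simp flip: of_nat_mult)
  then have r: "(\<Sum>k\<in>{0<..<p}. of_nat (p choose k) * x ^ k * y ^ (p - k)) = of_nat p * r"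
    unfolding r_def sum_distrib_left by (intro sum.cong refl) (simp add: mult_ac)
  have "{..p} = insert 0 (insert p {0<..<p})" using p0 by auto
  then have "(x + y) ^ p = x ^ p + y ^ p + of_nat p * r"
    unfolding binomial_ring using p0 by (simp flip: r)
  moreover have "r \<in> int_adjoin z"
    unfolding r_def using x y by (intro int_adjoin_closed)
  ultimately show ?thesis using that by blast
qed

text \<open>Induction over the summands: each \<open>(c j * z ^ j) ^ p\<close> collapses to
  \<open>c j ^ p\<close> because \<open>z ^ p = 1\<close>, and Fermat replaces this by
  \<open>c j\<close> modulo \<open>p\<close>.\<close>

lemma frobenius_int_adjoin:
  fixes c :: "nat \<Rightarrow> int"
  assumes p: "prime p" and z: "z ^ p = 1" and "finite I"
  shows "\<exists>r \<in> int_adjoin z. (\<Sum>i\<in>I. of_int (c i) * z ^ i) ^ p = of_int (\<Sum>i\<in>I. c i) + of_nat p * r"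
  using \<open>finite I\<close>
proof (induction I)
  case empty
  show ?case using p of_int_in_int_adjoin[of 0]
    by (intro bexI[of _ 0]) (auto simp: prime_gt_0_nat)
next
  case (insert j I)
  let ?x = "\<Sum>i\<in>I. of_int (c i) * z ^ i"
  obtain r where r: "r \<in> int_adjoin z" "?x ^ p = of_int (\<Sum>i\<in>I. c i) + of_nat p * r"
    using insert.IH by blast
  have in_R: "of_int (c j) * z ^ j \<in> int_adjoin z" "?x \<in> int_adjoin z"
    by (intro int_adjoin_closed)+
  obtain s where s: "s \<in> int_adjoin z"
    "(of_int (c j) * z ^ j + ?x) ^ p = (of_int (c j) * z ^ j) ^ p + ?x ^ p + of_nat p * s"
    using freshmans_dream_int_adjoin[OF p in_R] .
  have "int p dvd c j ^ p - c j" using fermat_int[OF p] by (simp add: cong_iff_dvd_diff)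
  then obtain d where "c j ^ p - c j = int p * d" ..
  then have "c j ^ p = c j + int p * d" by simp
  moreover have "(z ^ j) ^ p = (z ^ p) ^ j" by (simp only: mult.commute flip: power_mult)
  then have "(z ^ j) ^ p = 1" by (simp only: z power_one)
  ultimately have "(of_int (c j) * z ^ j) ^ p = of_int (c j + int p * d)"
    by (simp add: power_mult_distrib flip: of_int_power)
  then have "(\<Sum>i\<in>insert j I. of_int (c i) * z ^ i) ^ p
      = of_int (\<Sum>i\<in>insert j I. c i) + of_nat p * (r + s + of_int d)"
    using insert.hyps r(2) s(2) by (simp add: algebra_simps)
  moreover have "r + s + of_int d \<in> int_adjoin z" using r(1) s(1) by (intro int_adjoin_closed)
  ultimately show ?case by blast
qed

section \<open>The ring of integers of a prime cyclotomic field\<close>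

text \<open>All \<open>p\<close> powers of \<open>z\<close> add up to \<open>0\<close>; subtracting
  \<open>c (p - 1)\<close> times this sum cancels the last term.\<close>

lemma sum_powers_root_of_unity:
  fixes z :: complex and c :: "nat \<Rightarrow> int"
  assumes "z ^ p = 1" "z \<noteq> 1" "0 < p"
  shows "(\<Sum>i<p. of_int (c i) * z ^ i) = (\<Sum>i<p - 1. of_int (c i - c (p - 1)) * z ^ i)"
proof -
  have "(\<Sum>i<p. z ^ i) = 0" using assms by (simp add: sum_gp_strict)
  then have "(\<Sum>i<p. of_int (c i) * z ^ i)
      = (\<Sum>i<p. of_int (c i) * z ^ i) - of_int (c (p - 1)) * (\<Sum>i<p. z ^ i)" by simp
  also have "\<dots> = (\<Sum>i<p. of_int (c i - c (p - 1)) * z ^ i)"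
    by (simp add: sum_distrib_left sum_subtractf left_diff_distrib)
  also have "\<dots> = (\<Sum>i<Suc (p - 1). of_int (c i - c (p - 1)) * z ^ i)" using assms(3) by simp
  also have "\<dots> = (\<Sum>i<p - 1. of_int (c i - c (p - 1)) * z ^ i)" by (subst sum.lessThan_Suc) simp
  finally show ?thesis .
qed

text \<open>For integers \<open>c i * (c i - 1)\<close> is nonnegative and vanishes only at
  \<open>0\<close> and \<open>1\<close>. The two sums force all these terms to vanish.\<close>

lemma sum_eq_sum_squares_eq_1:
  fixes c :: "'a \<Rightarrow> int"
  assumes "finite I" and sum: "(\<Sum>i\<in>I. c i) = 1" and sq: "(\<Sum>i\<in>I. (c i)\<^sup>2) = 1"
  obtains m where "m \<in> I" "\<And>i. i \<in> I \<Longrightarrow> c i = (if i = m then 1 else 0)"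
proof -
  have "0 \<le> c i * (c i - 1)" for i by (simp add: zero_le_mult_iff) linarith
  then have ge: "0 \<le> (c i)\<^sup>2 - c i" for i by (simp add: power2_eq_square right_diff_distrib)
  have "(\<Sum>i\<in>I. (c i)\<^sup>2 - c i) = 0" using sum sq by (simp add: sum_subtractf)
  then have "(c i)\<^sup>2 - c i = 0" if "i \<in> I" for i
    using that ge \<open>finite I\<close> by (simp add: sum_nonneg_eq_0_iff)
  then have "c i * (c i - 1) = 0" if "i \<in> I" for i
    using that by (simp add: power2_eq_square right_diff_distrib)
  then have c01: "c i = 0 \<or> c i = 1" if "i \<in> I" for i
    using that by fastforce
  obtain m where m: "m \<in> I" "c m \<noteq> 0" using sum by (metis sum.neutral zero_neq_one)
  then have cm: "c m = 1" using c01 by blast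
  have "(\<Sum>i\<in>I - {m}. c i) = 0"
    using sum cm m(1) \<open>finite I\<close> by (simp add: sum.remove[of I m])
  moreover have "0 \<le> c i" if "i \<in> I - {m}" for i using c01[of i] that by auto
  ultimately have "\<forall>i\<in>I - {m}. c i = 0"
    using \<open>finite I\<close> by (subst (asm) sum_nonneg_eq_0_iff) auto
  then show ?thesis using that[of m] m(1) cm by auto
qed

text \<open>Independence of the powers enters as an assumption, which the theorem discharges from
  the given basis through \<open>generators_integral_basis\<close>.\<close>

locale prime_cyclotomic =
  fixes p :: nat and \<zeta> :: complex
  assumes prime: "prime p" and gt_2: "2 < p"
    and root: "primitive_root_of_unity p \<zeta>"
    and powers_basis: "integral_basis (int_adjoin \<zeta>) (p - 1) (\<lambda>i. \<zeta> ^ i)"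
begin

section \<open>Powers of \<open>\<zeta>\<close> and complex conjugation\<close>

lemma pos: "0 < p" using gt_2 by simp

lemma power_p: "\<zeta> ^ p = 1"
  using root unfolding primitive_root_of_unity_def by blast

lemma power_neq_1: "0 < m \<Longrightarrow> m < p \<Longrightarrow> \<zeta> ^ m \<noteq> 1"
  using root unfolding primitive_root_of_unity_def by blast

lemma neq_1: "\<zeta> \<noteq> 1"
  using power_neq_1[of 1] gt_2 by simp

lemma power_mod: "\<zeta> ^ (k mod p) = \<zeta> ^ k"
proof -
  have "\<zeta> ^ k = \<zeta> ^ (p * (k div p) + k mod p)" by simp
  also have "\<dots> = \<zeta> ^ (k mod p)" by (simp only: power_add power_mult power_p power_one mult_1)
  finally show ?thesis ..
qed

lemma cnj_power: "j \<le> p \<Longrightarrow> cnj (\<zeta> ^ j) = \<zeta> ^ (p - j)"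
proof -
  assume j: "j \<le> p"
  have "norm \<zeta> ^ p = 1 ^ p" using power_p by (simp flip: norm_power)
  then have "norm \<zeta> = 1" using pos by (metis power_eq_imp_eq_base norm_ge_zero zero_le_one)
  then have "\<zeta> ^ j * cnj (\<zeta> ^ j) = 1"
    by (simp only: norm_power power_one of_real_1 flip: complex_norm_square)
  moreover have "\<zeta> ^ j * \<zeta> ^ (p - j) = 1" using j power_p by (simp flip: power_add)
  ultimately show ?thesis by (metis mult.commute mult.left_commute mult.right_neutral)
qed

lemma cnj_in: "x \<in> int_adjoin \<zeta> \<Longrightarrow> cnj x \<in> int_adjoin \<zeta>"
  using int_adjoin_subset[OF cnj_in_int_adjoin_cnj] cnj_power[of 1] pos
  by (simp add: int_adjoin_closed)

section \<open>Divisibility read off from coefficients\<close>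

lemma relation_constant:
  fixes c :: "nat \<Rightarrow> int"
  assumes "(\<Sum>i<p. of_int (c i) * \<zeta> ^ i) = 0" "i < p"
  shows "c i = c (p - 1)"
proof (cases "i = p - 1")
  case False
  have "(\<Sum>i<p - 1. of_int (c i - c (p - 1)) * \<zeta> ^ i) = 0"
    using sum_powers_root_of_unity[OF power_p neq_1 pos, of c] assms(1) by simp
  then have "\<forall>i<p - 1. c i - c (p - 1) = 0"
    using powers_basis[unfolded integral_basis_def, THEN conjunct2, THEN conjunct2,
        THEN spec[where x = "\<lambda>i. c i - c (p - 1)"]] by blast
  then show ?thesis using False assms(2) by simp
qed simp

text \<open>Coefficients are determined only up to a common shift, so only their differences carry
  information: \<open>c - N * d\<close> is a relation, hence constant.\<close>

lemma dvd_coeff_diff: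
  fixes c :: "nat \<Rightarrow> int"
  assumes "(\<Sum>i<p. of_int (c i) * \<zeta> ^ i) = of_int N * y" "y \<in> int_adjoin \<zeta>" "i < p" "j < p"
  shows "N dvd c i - c j"
proof -
  obtain d :: "nat \<Rightarrow> int" where d: "y = (\<Sum>i<p. of_int (d i) * \<zeta> ^ i)"
    using int_adjoin_root_of_unity[OF power_p pos assms(2)] .
  have "(\<Sum>i<p. of_int (c i - N * d i) * \<zeta> ^ i) = 0"
    using assms(1) by (simp add: d left_diff_distrib sum_subtractf sum_distrib_left mult.assoc)
  then have "c i - N * d i = c j - N * d j"
    using relation_constant[of "\<lambda>i. c i - N * d i"] assms(3,4) by metis
  then have "c i - c j = N * (d i - d j)" by (simp add: algebra_simps)
  then show ?thesis by simp
qed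

lemma dvd_of_int:
  assumes "of_int a = of_int N * y" "y \<in> int_adjoin \<zeta>"
  shows "N dvd a"
proof -
  have "(\<Sum>i<p. of_int (if i = 0 then a else 0) * \<zeta> ^ i) = (\<Sum>i<p. if i = 0 then of_int a else 0)"
    by (intro sum.cong) auto
  also have "\<dots> = of_int N * y" using pos assms(1) by simp
  finally show ?thesis using dvd_coeff_diff[of "\<lambda>i. if i = 0 then a else 0" N y 0 1] assms(2) gt_2 by simp
qed

lemma dvd_power_minus_1:
  assumes "\<zeta> ^ m - 1 = of_int N * y" "y \<in> int_adjoin \<zeta>" "\<not> p dvd m"
  shows "N dvd 1"
proof -
  define k where "k = m mod p"
  have k: "k < p" "k \<noteq> 0" using assms(3) pos by (auto simp: k_def dvd_eq_mod_eq_0)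
  define c :: "nat \<Rightarrow> int" where "c i = (if i = k then 1 else 0) - (if i = 0 then 1 else 0)" for i
  have "(\<Sum>i<p. of_int (c i) * \<zeta> ^ i)
      = (\<Sum>i<p. if i = k then \<zeta> ^ i else 0) - (\<Sum>i<p. if i = 0 then \<zeta> ^ i else 0)"
    unfolding sum_subtractf[symmetric] by (intro sum.cong) (auto simp: c_def)
  also have "\<dots> = \<zeta> ^ k - 1" using k pos by simp
  also have "\<dots> = of_int N * y" using assms(1) by (simp add: k_def power_mod)
  finally have dvd: "N dvd c i - c j" if "i < p" "j < p" for i j
    using dvd_coeff_diff[OF _ assms(2) that] by blast
  \<comment> \<open>As \<open>p > 2\<close>, there is an index \<open>j\<close> besides
    \<open>0\<close> and \<open>k\<close>. Its coefficient is \<open>0\<close>, while that of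
    \<open>k\<close> is \<open>1\<close>.\<close>
  define j where "j = (if k = 1 then 2 else 1 :: nat)"
  have "j < p" "c k - c j = 1" using k gt_2 by (auto simp: j_def c_def)
  then show ?thesis using dvd[of k j] k by simp
qed

text \<open>The coefficients \<open>a d\<close> of \<open>w * cnj w\<close> are the cyclic autocorrelations of \<open>c\<close>. They add up to
  \<open>(\<Sum>i<p. c i)\<^sup>2\<close>, and all of them but \<open>a 0 = (\<Sum>i<p. (c i)\<^sup>2)\<close> agree, with \<open>a 0\<close> larger by one.\<close>
lemma sum_squares_of_norm_1:
  fixes c :: "nat \<Rightarrow> int"
  defines "w \<equiv> \<Sum>i<p. of_int (c i) * \<zeta> ^ i"
  assumes norm: "w * cnj w = 1" and sum: "(\<Sum>i<p. c i) = 1"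
  shows "(\<Sum>i<p. (c i)\<^sup>2) = 1"
proof -
  define P where "P = {..<p} \<times> {..<p}"
  \<comment> \<open>The difference of the two indices modulo \<open>p\<close>, written so that
    natural subtraction is exact on \<open>P\<close>.\<close>
  define f where "f x = (fst x + (p - snd x)) mod p" for x :: "nat \<times> nat"
  define g where "g x = c (fst x) * c (snd x)" for x
  define a where "a d = (\<Sum>x\<in>{x \<in> P. f x = d}. g x)" for d
  have P: "finite P" "f ` P \<subseteq> {..<p}" using pos by (auto simp: P_def f_def)
  have mono: "\<zeta> ^ i * cnj (\<zeta> ^ j) = \<zeta> ^ f (i, j)" if "j < p" for i j
    using that by (simp only: cnj_power[OF less_imp_le] f_def power_mod power_add fst_conv snd_conv)
  have "w * cnj w = (\<Sum>i<p. \<Sum>j<p. of_int (c i * c j) * (\<zeta> ^ i * cnj (\<zeta> ^ j)))"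
    unfolding w_def by (simp add: sum_product mult_ac)
  also have "\<dots> = (\<Sum>i<p. \<Sum>j<p. of_int (g (i, j)) * \<zeta> ^ f (i, j))"
    by (intro sum.cong refl) (simp only: mono lessThan_iff g_def fst_conv snd_conv)
  also have "\<dots> = (\<Sum>x\<in>P. of_int (g x) * \<zeta> ^ f x)"
    by (simp add: P_def sum.cartesian_product)
  also have "\<dots> = (\<Sum>d<p. \<Sum>x\<in>{x \<in> P. f x = d}. of_int (g x) * \<zeta> ^ f x)"
    using P by (intro sum.group[symmetric]) auto
  also have "\<dots> = (\<Sum>d<p. of_int (a d) * \<zeta> ^ d)"
    by (intro sum.cong refl) (simp add: a_def sum_distrib_right)
  finally have a: "(\<Sum>d<p. of_int (a d) * \<zeta> ^ d) = 1" using norm by simp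
  \<comment> \<open>The coefficients of the constant \<open>1\<close>, so that \<open>a - e\<close>
    is a relation and therefore constant.\<close>
  define e :: "nat \<Rightarrow> int" where "e d = (if d = 0 then 1 else 0)" for d
  have "(\<Sum>d<p. of_int (e d) * \<zeta> ^ d) = (\<Sum>d<p. if d = 0 then 1 else 0)"
    by (intro sum.cong) (auto simp: e_def)
  then have "(\<Sum>d<p. of_int (a d - e d) * \<zeta> ^ d) = 0"
    using a pos by (simp add: left_diff_distrib sum_subtractf)
  then obtain t where t: "\<And>d. d < p \<Longrightarrow> a d - e d = t"
    using relation_constant[of "\<lambda>d. a d - e d"] by blast
  have "(\<Sum>d<p. a d) = (\<Sum>x\<in>P. g x)"
    unfolding a_def using P by (intro sum.group) auto
  also have "\<dots> = (\<Sum>i<p. c i) * (\<Sum>i<p. c i)"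
    by (simp add: P_def g_def sum_product sum.cartesian_product split_def)
  \<comment> \<open>Both families add up to \<open>1\<close>, so \<open>p * t = 0\<close> for the
    constant \<open>t\<close>.\<close>
  finally have "(\<Sum>d<p. a d - e d) = 0" using sum pos by (simp add: sum_subtractf e_def)
  then have "t = 0" using t pos by simp
  then have "a 0 = 1" using t[of 0] pos by (simp add: e_def)
  moreover have "{x \<in> P. f x = 0} = (\<lambda>i. (i, i)) ` {..<p}"
  proof -
    have "f (i, j) = 0 \<longleftrightarrow> i = j" if "i < p" "j < p" for i j
    proof (cases "j \<le> i")
      case True
      then have "f (i, j) = (p + (i - j)) mod p" using that by (simp add: f_def add.commute)
      also have "\<dots> = i - j" using that by (simp only: mod_add_self1) simp
      finally show ?thesis using True by simp
    qed (use that in \<open>simp add: f_def\<close>)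
    then show ?thesis by (auto simp: P_def)
  qed
  ultimately show ?thesis
    by (simp add: a_def g_def sum.reindex inj_on_def power2_eq_square)
qed

section \<open>Units, Kummer's lemma and powers congruent to 1\<close>

lemma unit_frobenius:
  assumes "unit_in (int_adjoin \<zeta>) u"
  obtains a r where "r \<in> int_adjoin \<zeta>" "u ^ p = of_int a + of_nat p * r" "\<not> int p dvd a"
proof -
  have frob: "\<exists>a. \<exists>r\<in>int_adjoin \<zeta>. x ^ p = of_int a + of_nat p * r" if x: "x \<in> int_adjoin \<zeta>" for x
  proof -
    obtain c :: "nat \<Rightarrow> int" where "x = (\<Sum>i<p. of_int (c i) * \<zeta> ^ i)"
      using int_adjoin_root_of_unity[OF power_p pos x] .
    then show ?thesis using frobenius_int_adjoin[OF prime power_p, of "{..<p}" c] by blast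
  qed
  obtain v where v: "v \<in> int_adjoin \<zeta>" "u * v = 1" and u: "u \<in> int_adjoin \<zeta>"
    using assms unfolding unit_in_def by blast
  obtain a r where r: "r \<in> int_adjoin \<zeta>" "u ^ p = of_int a + of_nat p * r" using frob[OF u] by blast
  obtain a' s where s: "s \<in> int_adjoin \<zeta>" "v ^ p = of_int a' + of_nat p * s"
    using frob[OF v(1)] by blast
  \<comment> \<open>Multiplying the congruences for \<open>u\<close> and its inverse
    \<open>v\<close> gives \<open>a * a' \<equiv> 1\<close> modulo \<open>p\<close>.\<close>
  have "(of_int a + of_nat p * r) * (of_int a' + of_nat p * s) = 1"
    using v(2) by (simp flip: r(2) s(2) power_mult_distrib)
  then have "of_int (1 - a * a') = of_int (int p) * (of_int a * s + r * of_int a' + of_nat p * r * s)"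
    by (simp add: algebra_simps)
  moreover have "of_int a * s + r * of_int a' + of_nat p * r * s \<in> int_adjoin \<zeta>"
    using r(1) s(1) by (intro int_adjoin_closed)
  ultimately have dvd: "int p dvd 1 - a * a'" by (rule dvd_of_int)
  have "\<not> int p dvd a"
  proof
    assume "int p dvd a"
    then have "int p dvd (1 - a * a') + a * a'" using dvd by (intro dvd_add dvd_mult2)
    then show False using gt_2 by simp
  qed
  then show ?thesis using that r by blast
qed

text \<open>Kummer's lemma. No sign occurs, since \<open>-\<zeta> ^ m\<close> has coefficient sum
  \<open>-1\<close> modulo \<open>p\<close>, whereas that of \<open>w\<close> is
  \<open>1\<close>.\<close>

lemma unit_eq_power_mult_cnj:
  assumes u: "unit_in (int_adjoin \<zeta>) u"
  obtains m where "m < p" "u = \<zeta> ^ m * cnj u"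
proof -
  obtain v where v: "v \<in> int_adjoin \<zeta>" "u * v = 1" and u_in: "u \<in> int_adjoin \<zeta>"
    using u unfolding unit_in_def by blast
  \<comment> \<open>Since \<open>cnj v\<close> inverts \<open>cnj u\<close>, this is
    \<open>u / cnj u\<close>, visibly an element of the ring.\<close>
  define w where "w = u * cnj v"
  have cv: "cnj u * cnj v = 1" using v(2) by (metis complex_cnj_mult complex_cnj_one)
  have "w * cnj w = (u * v) * (cnj u * cnj v)" by (simp add: w_def mult_ac)
  then have norm: "w * cnj w = 1" using v(2) cv by simp
  have "w * cnj u = u * (cnj u * cnj v)" by (simp add: w_def mult_ac)
  then have uw: "u = w * cnj u" using cv by simp
  have w: "w \<in> int_adjoin \<zeta>" unfolding w_def using u_in v(1) by (intro int_adjoin_closed cnj_in)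
  obtain c :: "nat \<Rightarrow> int" where c: "w = (\<Sum>i<p. of_int (c i) * \<zeta> ^ i)"
    using int_adjoin_root_of_unity[OF power_p pos w] .
  define S where "S = (\<Sum>i<p. c i)"
  obtain r where r: "r \<in> int_adjoin \<zeta>" "w ^ p = of_int S + of_nat p * r"
    using frobenius_int_adjoin[OF prime power_p, of "{..<p}" c] unfolding c S_def by blast
  obtain a s where s: "s \<in> int_adjoin \<zeta>" "u ^ p = of_int a + of_nat p * s" and a: "\<not> int p dvd a"
    using unit_frobenius[OF u] .
  \<comment> \<open>The integer \<open>a\<close> is fixed by conjugation, so \<open>u\<close> and
    \<open>cnj u\<close> share it; then \<open>u ^ p = w ^ p * cnj u ^ p\<close> reads
    \<open>a \<equiv> S * a\<close> modulo \<open>p\<close>.\<close>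
  have "cnj u ^ p = of_int a + of_nat p * cnj s" using s(2) by (simp flip: complex_cnj_power)
  then have "of_int a + of_nat p * s = (of_int S + of_nat p * r) * (of_int a + of_nat p * cnj s)"
    using arg_cong[OF uw, of "\<lambda>x. x ^ p"] s(2) r(2) by (simp only: power_mult_distrib)
  then have "of_int (a * (S - 1))
      = of_int (int p) * (s - (of_int S * cnj s + r * of_int a + of_nat p * r * cnj s))"
    by (simp add: algebra_simps)
  moreover have "s - (of_int S * cnj s + r * of_int a + of_nat p * r * cnj s) \<in> int_adjoin \<zeta>"
    using r(1) s(1) by (intro int_adjoin_closed cnj_in)
  ultimately have "int p dvd a * (S - 1)" by (rule dvd_of_int)
  then have "int p dvd S - 1" using a prime by (simp add: prime_dvd_mult_iff)
  then obtain t where "S - 1 = int p * t" ..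
  \<comment> \<open>As the powers of \<open>\<zeta>\<close> add up to \<open>0\<close>, all coefficients of \<open>w\<close> may be shifted by \<open>t\<close>.\<close>
  define c' where "c' i = c i - t" for i
  have c': "w = (\<Sum>i<p. of_int (c' i) * \<zeta> ^ i)"
    unfolding c using sum_powers_root_of_unity[OF power_p neq_1 pos, of c]
      sum_powers_root_of_unity[OF power_p neq_1 pos, of c'] by (simp add: c'_def)
  have sum: "(\<Sum>i<p. c' i) = 1"
    using \<open>S - 1 = int p * t\<close> by (simp add: c'_def sum_subtractf S_def)
  have "(\<Sum>i<p. (c' i)\<^sup>2) = 1"
    using sum_squares_of_norm_1[of c'] norm sum unfolding c' by blast
  then obtain m where m: "m < p" "\<And>i. i < p \<Longrightarrow> c' i = (if i = m then 1 else 0)"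
    using sum_eq_sum_squares_eq_1[of "{..<p}" c'] sum by auto
  have "w = (\<Sum>i<p. if i = m then \<zeta> ^ i else 0)"
    unfolding c' by (intro sum.cong) (auto simp: m(2))
  then have "w = \<zeta> ^ m" using m(1) by simp
  then show ?thesis using that m(1) uw by blast
qed

text \<open>In \<open>u ^ n = \<zeta> ^ (m * n) * cnj (u ^ n)\<close> both \<open>u ^ n\<close> and
  its conjugate are \<open>1\<close> modulo \<open>N\<close>, so \<open>\<zeta> ^ (m * n)\<close> is
  as well.\<close>

lemma unit_power_cong_1:
  assumes u: "unit_in (int_adjoin \<zeta>) u" "u \<notin> \<real>"
    and y: "u ^ n - 1 = of_int N * y" "y \<in> int_adjoin \<zeta>" and n: "\<not> p dvd n"
  shows "N dvd 1"
proof -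
  obtain m where m: "m < p" "u = \<zeta> ^ m * cnj u" using unit_eq_power_mult_cnj[OF u(1)] .
  have "m \<noteq> 0"
  proof
    assume "m = 0"
    then have "cnj u = u" using m(2) by simp
    then show False using u(2) by (simp add: Reals_cnj_iff)
  qed
  then have "\<not> p dvd m * n" using m(1) n prime by (auto simp: prime_dvd_mult_iff dest: dvd_imp_le)
  moreover have "\<zeta> ^ (m * n) - 1 = of_int N * (y - \<zeta> ^ (m * n) * cnj y)"
  proof -
    have un: "u ^ n = \<zeta> ^ (m * n) * cnj (u ^ n)"
      using arg_cong[OF m(2), of "\<lambda>x. x ^ n"] 
      unfolding power_mult_distrib power_mult complex_cnj_power .
    have "cnj (u ^ n) - 1 = of_int N * cnj y" using arg_cong[OF y(1), of cnj] by simp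
    then have "cnj (u ^ n) = 1 + of_int N * cnj y" by (simp add: algebra_simps)
    moreover have "u ^ n = 1 + of_int N * y" using y(1) by (simp add: algebra_simps)
    ultimately have "1 + of_int N * y = \<zeta> ^ (m * n) * (1 + of_int N * cnj y)" using un by simp
    then show ?thesis by (simp add: algebra_simps)
  qed
  moreover have "y - \<zeta> ^ (m * n) * cnj y \<in> int_adjoin \<zeta>"
    using y(2) by (intro int_adjoin_closed cnj_in)
  ultimately show ?thesis using dvd_power_minus_1 by blast
qed

end

theorem theorem1p3:
  fixes p :: nat and \<zeta> u :: complex and b :: "nat \<Rightarrow> complex" and A :: "int mat"
  assumes "prime p" and "p > 3"
    and "primitive_root_of_unity p \<zeta>"
    and "unit_in (int_adjoin \<zeta>) u" and "u \<notin> \<real>"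
    and "integral_basis (int_adjoin \<zeta>) (p - 1) b"
    and "is_matrix_of (p - 1) b (\<lambda>x. u * x) A"
  shows "A \<in> special_linear_int (p - 1) \<and>
    (\<forall>k :: int. \<not> [k = 0] (mod int p) \<longrightarrow> primitive_mat (int_mat_power (p - 1) A k))"
proof -
  let ?M = "ring_mat TYPE(int) (p - 1) ()"
  note u = assms(4) and b = assms(6) and A = assms(7)
  have pos: "0 < p" and root: "\<zeta> ^ p = 1" and "\<zeta> ^ 1 \<noteq> 1"
    using assms(2,3) unfolding primitive_root_of_unity_def by auto
  have "integral_basis (int_adjoin \<zeta>) (p - 1) (\<lambda>i. \<zeta> ^ i)"
  proof (rule generators_integral_basis[OF b])
    fix x assume "x \<in> int_adjoin \<zeta>"
    then obtain c :: "nat \<Rightarrow> int" where "x = (\<Sum>i<p. of_int (c i) * \<zeta> ^ i)"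
      using int_adjoin_root_of_unity[OF root pos] by blast
    then have "x = (\<Sum>i<p - 1. of_int (c i - c (p - 1)) * \<zeta> ^ i)"
      using sum_powers_root_of_unity[OF root _ pos, of c] \<open>\<zeta> ^ 1 \<noteq> 1\<close> by simp
    then show "\<exists>c :: nat \<Rightarrow> int. x = (\<Sum>i<p - 1. of_int (c i) * \<zeta> ^ i)"
      by (rule exI[of _ "\<lambda>i. c i - c (p - 1)"])
  qed (intro int_adjoin_closed)
  then interpret prime_cyclotomic p \<zeta> using assms(1-3) by unfold_locales auto
  interpret M: ring ?M by (rule ring_mat)
  have A_carr: "A \<in> carrier_mat (p - 1) (p - 1)" using A unfolding is_matrix_of_def by blast
  obtain B where B: "B \<in> carrier_mat (p - 1) (p - 1)" "A * B = 1\<^sub>m (p - 1)" "B * A = 1\<^sub>m (p - 1)"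
    using is_matrix_of_inverse[OF b mult_in_int_adjoin u A] .

  have "det A * det B = 1" using det_mult[OF A_carr B(1)] B(2) by simp
  then have det_cases: "det A = 1 \<or> det A = - 1" by (rule pos_zmult_eq_1_iff_lemma)
  obtain a r where r: "r \<in> int_adjoin \<zeta>" "u ^ p = of_int a + of_nat p * r" and a: "\<not> int p dvd a"
    using unit_frobenius[OF u] .
  obtain C where C: "is_matrix_of (p - 1) b (\<lambda>x. r * x) C"
    using ex1_is_matrix_of[OF b, of "\<lambda>x. r * x"] r(1) mult_in_int_adjoin by blast
  have C_carr: "C \<in> carrier_mat (p - 1) (p - 1)" using C unfolding is_matrix_of_def by blast
  \<comment> \<open>The matrix of \<open>u ^ p\<close> is found twice, as
    \<open>a * I + p * C\<close> and as a power of \<open>A\<close>; uniqueness equates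
    them.\<close>
  have "is_matrix_of (p - 1) b (\<lambda>x. u ^ p * x) (a \<cdot>\<^sub>m 1\<^sub>m (p - 1) + int p \<cdot>\<^sub>m C)"
    using is_matrix_of_affine[OF C, of a "int p"] by (simp add: r(2))
  moreover have "\<exists>!D. is_matrix_of (p - 1) b (\<lambda>x. u ^ p * x) D"
    using u by (intro ex1_is_matrix_of[OF b]) (auto simp: unit_in_def intro!: int_adjoin_closed)
  ultimately have "A [^]\<^bsub>?M\<^esub> p = a \<cdot>\<^sub>m 1\<^sub>m (p - 1) + int p \<cdot>\<^sub>m C"
    using is_matrix_of_power[OF A, of p] by blast
  moreover have "[det (a \<cdot>\<^sub>m 1\<^sub>m (p - 1) + int p \<cdot>\<^sub>m C) = det (a \<cdot>\<^sub>m 1\<^sub>m (p - 1))] (mod int p)"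
    using C_carr by (intro det_cong[of _ "p - 1"]) (auto simp: cong_iff_dvd_diff)
  ultimately have "[det A ^ p = a ^ (p - 1)] (mod int p)"
    using det_nat_pow[OF A_carr, of p] by simp
  moreover have "[a ^ (p - 1) = 1] (mod int p)"
  proof -
    have "int p dvd a ^ p - a" using fermat_int[OF prime] by (simp add: cong_iff_dvd_diff)
    also have "a ^ p - a = a * (a ^ (p - 1) - 1)"
      using pos by (simp add: right_diff_distrib power_eq_if)
    finally show ?thesis using a prime by (simp add: prime_dvd_mult_iff cong_iff_dvd_diff)
  qed
  ultimately have det_p: "[det A ^ p = 1] (mod int p)" by (rule cong_trans)
  \<comment> \<open>For odd \<open>p\<close> the value \<open>-1\<close> would give
    \<open>-1 \<equiv> 1\<close> modulo \<open>p\<close>, impossible for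
    \<open>p > 2\<close>.\<close>
  have "det A \<noteq> - 1"
  proof
    assume "det A = - 1"
    moreover have "odd p" using prime gt_2 prime_odd_nat by blast
    ultimately have "int p dvd 2" using det_p by (simp add: cong_iff_dvd_diff)
    then show False using gt_2 zdvd_imp_le by fastforce
  qed
  then have "A \<in> special_linear_int (p - 1)"
    using det_cases A_carr unfolding special_linear_int_def by simp

  moreover have "primitive_mat (int_mat_power (p - 1) A k)" if k: "\<not> [k = 0] (mod int p)" for k :: int
  proof -
    \<comment> \<open>The power is \<open>D\<close> or its inverse, with exponent
      \<open>n = \<bar>k\<bar>\<close> in \<open>D\<close>.\<close>
    define n where "n = nat \<bar>k\<bar>"
    have n: "\<not> p dvd n" using k by (simp add: n_def cong_0_iff flip: int_dvd_int_iff)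
    define D where "D = A [^]\<^bsub>?M\<^esub> n"
    have A_unit: "A \<in> Units ?M" using A_carr B by (auto simp: Units_def ring_mat_simps)
    have D_unit: "D \<in> Units ?M" unfolding D_def by (rule M.Units_pow_closed[OF A_unit])
    have D_carr: "D \<in> carrier_mat (p - 1) (p - 1)"
      using M.Units_closed[OF D_unit] by (simp add: ring_mat_simps)
    have inv_carr: "inv\<^bsub>?M\<^esub> D \<in> carrier_mat (p - 1) (p - 1)"
      using M.Units_inv_closed[OF D_unit] by (simp add: ring_mat_simps)
    have inv: "inv\<^bsub>?M\<^esub> D * D = 1\<^sub>m (p - 1)"
      using M.Units_l_inv[OF D_unit] by (simp add: ring_mat_simps)
    have unit: "N dvd 1"
      if N: "\<And>i j. i < p - 1 \<Longrightarrow> j < p - 1 \<Longrightarrow> N dvd D $$ (i, j) - 1\<^sub>m (p - 1) $$ (i, j)" for N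
    proof -
      obtain y where "y \<in> int_adjoin \<zeta>" "u ^ n - 1 = of_int N * y"
        using cong_1_of_matrix_cong_1[OF b is_matrix_of_power[OF A, of n] N[unfolded D_def]] .
      then show ?thesis using unit_power_cong_1[OF u assms(5) _ _ n] by blast
    qed
    show ?thesis
    proof (cases "k < 0")
      case True
      then have "n = nat (- k)" by (simp add: n_def)
      then have "int_mat_power (p - 1) A k = inv\<^bsub>?M\<^esub> D"
        using True by (simp only: int_pow_def2 D_def if_True)
      moreover have "primitive_mat (inv\<^bsub>?M\<^esub> D)"
        \<comment> \<open>A common divisor of the entries of \<open>inv D - I\<close> also divides
          those of \<open>D - I\<close>.\<close>
        using unit dvd_minus_one_of_inverse[OF D_carr inv_carr inv]
        by (intro primitive_matI[OF inv_carr]) presburger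
      ultimately show ?thesis by simp
    next
      case False
      then have "n = nat k" by (simp add: n_def)
      then have "int_mat_power (p - 1) A k = D"
        using False by (simp only: int_pow_def2 D_def if_False)
      moreover have "primitive_mat D" using primitive_matI[OF D_carr unit] .
      ultimately show ?thesis by simp
    qed
  qed
  ultimately show ?thesis by blast
qed

end
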